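(* Let $(X_k)$ be a bidecomposition in a Banach lattice $X$, and let $T\colon[X_k]\to Y$ be a sequentially uniformly continuous norm isomorphic embedding into a Banach lattice $Y$. Then the sequence $(TX_k)$ is a bidecomposition.
   Context: For a sequence $(X_k)$ of closed non-zero subspaces of a Banach space $X$, $[X_k]$ denotes the closed linear span of $\bigcup_kX_k$. $(X_k)$ is a Schauder decomposition of $[X_k]$ if every $x\in[X_k]$ has a unique expansion $x=\sum_{k=1}^\infty x_k$ (norm convergent) with $x_k\in X_k$; the canonical projections are $P_nx=\sum_{k=1}^nx_k$. In a vector lattice, $z_n\to z$ uniformly means that there is $e\ge0$ such that for every $\varepsilon>0$ there is $n_0$ with $|z_n-z|\le\varepsilon e$ for all $n\ge n_0$. A Schauder decomposition $(X_k)$ in a Banach lattice $X$ is a bidecomposition if $P_nx\to x$ uniformly (in $X$) for every $x\in[X_k]$; equivalently, if there is $M\ge1$ such that $\bigl\|\bigvee_{n=1}^m|\sum_{k=1}^nx_k|\bigr\|\le M\bigl\|\sum_{k=1}^mx_k\bigr\|$ for all $m$ and all $x_k\in X_k$, $k=1,\dots,m$. The spaces $X_k$ and $[X_k]$ need not be sublattices. A linear operator $T\colon Z\to Y$ from a linear subspace $Z$ of a vector lattice $X$ to a vector lattice $Y$ is sequentially uniformly continuous if for every sequence $(z_n)$ in $Z$ such that $z_n\to0$ uniformly in $X$ one has $Tz_n\to0$ uniformly in $Y$. A norm isomorphic embedding is a bounded linear operator which is bounded below. *)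

theory Defs
  imports "HOL-Analysis.Analysis" "HOL-Library.Lattice_Algebras"
begin

class vector_lattice = ordered_real_vector + lattice_ab_group_add_abs

class banach_lattice = banach + vector_lattice +
  assumes norm_mono_abs: "\<bar>x\<bar> \<le> \<bar>y\<bar> \<Longrightarrow> norm x \<le> norm y"

definition unif_tendsto :: "(nat \<Rightarrow> 'a::vector_lattice) \<Rightarrow> 'a \<Rightarrow> bool" where
  "unif_tendsto z l \<longleftrightarrow>
     (\<exists>e\<ge>0. \<forall>\<epsilon>>0. \<exists>n0. \<forall>n\<ge>n0. \<bar>z n - l\<bar> \<le> \<epsilon> *\<^sub>R e)"

definition closed_span :: "(nat \<Rightarrow> 'a::real_normed_vector set) \<Rightarrow> 'a set" where
  "closed_span X = closure (span (\<Union>k. X k))"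

(* Sequences of subspaces are indexed from 0, so that expansions are series in the sense of sums. *)

definition is_expansion :: "(nat \<Rightarrow> 'a::real_normed_vector set) \<Rightarrow> (nat \<Rightarrow> 'a) \<Rightarrow> 'a \<Rightarrow> bool" where
  "is_expansion X c x \<longleftrightarrow> (\<forall>k. c k \<in> X k) \<and> c sums x"

definition schauder_decomposition :: "(nat \<Rightarrow> 'a::banach set) \<Rightarrow> bool" where
  "schauder_decomposition X \<longleftrightarrow>
     (\<forall>k. subspace (X k) \<and> closed (X k) \<and> X k \<noteq> {0}) \<and>
     (\<forall>x\<in>closed_span X. \<exists>!c. is_expansion X c x)"

(* Because of the index shift, canonical_proj X n is the sum of the first n components.
   It is meaningful only on closed_span X for a Schauder decomposition X. *)
definition canonical_proj :: "(nat \<Rightarrow> 'a::banach set) \<Rightarrow> nat \<Rightarrow> 'a \<Rightarrow> 'a" where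
  "canonical_proj X n x = (\<Sum>k<n. (THE c. is_expansion X c x) k)"

definition bidecomposition :: "(nat \<Rightarrow> 'a::banach_lattice set) \<Rightarrow> bool" where
  "bidecomposition X \<longleftrightarrow>
     schauder_decomposition X \<and>
     (\<forall>x\<in>closed_span X. unif_tendsto (\<lambda>n. canonical_proj X n x) x)"

(* An operator on a subspace Z is represented by a total function; its values outside Z
   are irrelevant. *)

definition linear_operator_on :: "'a::real_vector set \<Rightarrow> ('a \<Rightarrow> 'b::real_vector) \<Rightarrow> bool" where
  "linear_operator_on Z T \<longleftrightarrow>
     subspace Z \<and>
     (\<forall>x\<in>Z. \<forall>y\<in>Z. T (x + y) = T x + T y) \<and>
     (\<forall>r. \<forall>x\<in>Z. T (r *\<^sub>R x) = r *\<^sub>R T x)"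

(* The regulator witnessing z -> 0 ranges over the whole ambient lattice, not just Z. *)
definition seq_unif_continuous_on ::
    "'a::vector_lattice set \<Rightarrow> ('a \<Rightarrow> 'b::vector_lattice) \<Rightarrow> bool" where
  "seq_unif_continuous_on Z T \<longleftrightarrow>
     linear_operator_on Z T \<and>
     (\<forall>z. (\<forall>n. z n \<in> Z) \<longrightarrow> unif_tendsto z 0 \<longrightarrow> unif_tendsto (\<lambda>n. T (z n)) 0)"

definition norm_isomorphic_embedding_on ::
    "'a::real_normed_vector set \<Rightarrow> ('a \<Rightarrow> 'b::real_normed_vector) \<Rightarrow> bool" where
  "norm_isomorphic_embedding_on Z T \<longleftrightarrow>
     linear_operator_on Z T \<and>
     (\<exists>C. \<forall>x\<in>Z. norm (T x) \<le> C * norm x) \<and>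
     (\<exists>c>0. \<forall>x\<in>Z. c * norm x \<le> norm (T x))"

end

theory Submission
  imports Defs
begin

text \<open>
  A norm isomorphic embedding preserves and reflects convergence of series, so the expansions
  along \<open>T ` X k\<close> are exactly the \<open>T\<close>-images of the expansions along \<open>X k\<close>, and the canonical
  projections of the two decompositions are intertwined by \<open>T\<close>. Sequential uniform continuity
  applied to \<open>P\<^sub>n x - x\<close> then transfers the uniform convergence.
\<close>

section \<open>Operators that are linear only on a subspace\<close>

lemma linear_operator_on_zero:
  assumes "linear_operator_on Z T"
  shows "T 0 = 0"
proof -
  have "T (0 *\<^sub>R 0) = 0 *\<^sub>R T 0"
    using assms unfolding linear_operator_on_def by (blast intro: subspace_0)
  then show ?thesis
    by simp
qed

lemma linear_operator_on_diff:
  assumes "linear_operator_on Z T" "x \<in> Z" "y \<in> Z"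
  shows "T (x - y) = T x - T y"
proof -
  have "T x = T (x - y) + T y"
    using assms unfolding linear_operator_on_def by (metis diff_add_cancel subspace_diff)
  then show ?thesis
    by simp
qed

lemma linear_operator_on_sum:
  fixes Z :: "'a::real_vector set" and T :: "'a \<Rightarrow> 'b::real_vector"
  assumes lin: "linear_operator_on Z T" and "\<And>k. c k \<in> Z"
  shows "T (\<Sum>k\<in>A. c k) = (\<Sum>k\<in>A. T (c k))"
proof (induction A rule: infinite_finite_induct)
  case (insert a A)
  have "(\<Sum>k\<in>A. c k) \<in> Z"
    using assms unfolding linear_operator_on_def by (blast intro: subspace_sum)
  then show ?case
    using insert assms unfolding linear_operator_on_def by simp
\<comment> \<open>Sums over an infinite index set are 0 by convention, so the infinite case and the
  empty case both amount to \<open>T 0 = 0\<close>.\<close>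
qed (simp_all add: linear_operator_on_zero[OF lin])

lemma linear_operator_on_subspace_image:
  assumes lin: "linear_operator_on Z T" and S: "subspace S" "S \<subseteq> Z"
  shows "subspace (T ` S)"
proof (rule subspaceI)
  show "0 \<in> T ` S"
    using linear_operator_on_zero[OF lin] subspace_0[OF S(1)] by (metis image_eqI)
next
  fix u v assume "u \<in> T ` S" "v \<in> T ` S"
  then obtain x y where "x \<in> S" "y \<in> S" "u = T x" "v = T y"
    by blast
  moreover from this have "T (x + y) = u + v"
    using lin S(2) unfolding linear_operator_on_def by blast
  ultimately show "u + v \<in> T ` S"
    using subspace_add[OF S(1)] by (metis image_eqI)
next
  fix r u assume "u \<in> T ` S"
  then obtain x where "x \<in> S" "u = T x"
    by blast
  moreover from this have "T (r *\<^sub>R x) = r *\<^sub>R u"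
    using lin S(2) unfolding linear_operator_on_def by blast
  ultimately show "r *\<^sub>R u \<in> T ` S"
    using subspace_scale[OF S(1)] by (metis image_eqI)
qed

section \<open>Convergence and closedness under norm isomorphic embeddings\<close>

text \<open>By linearity only null sequences matter. The upper bound \<open>C\<close> then gives
  preservation of convergence, and the lower bound \<open>c\<close> gives its reflection.\<close>

lemma embedding_tendsto_iff:
  assumes emb: "norm_isomorphic_embedding_on Z T" and z: "\<And>n. z n \<in> Z" and x: "x \<in> Z"
  shows "(\<lambda>n. T (z n)) \<longlonglongrightarrow> T x \<longleftrightarrow> z \<longlonglongrightarrow> x"
proof -
  obtain C c where C: "\<And>w. w \<in> Z \<Longrightarrow> norm (T w) \<le> C * norm w"
    and c: "c > 0" "\<And>w. w \<in> Z \<Longrightarrow> c * norm w \<le> norm (T w)"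
    and lin: "linear_operator_on Z T"
    using emb unfolding norm_isomorphic_embedding_on_def by blast
  have mem: "z n - x \<in> Z" for n
    using lin z x unfolding linear_operator_on_def by (blast intro: subspace_diff)
  have "(\<lambda>n. T (z n)) \<longlonglongrightarrow> T x \<longleftrightarrow> (\<lambda>n. T (z n - x)) \<longlonglongrightarrow> 0"
    by (simp add: linear_operator_on_diff[OF lin z x] flip: LIM_zero_iff[of _ "T x"])
  also have "\<dots> \<longleftrightarrow> (\<lambda>n. z n - x) \<longlonglongrightarrow> 0"
  proof
    assume lim: "(\<lambda>n. T (z n - x)) \<longlonglongrightarrow> 0"
    have "norm (z n - x) \<le> norm (T (z n - x)) * (1 / c)" for n
      using c(2)[OF mem, of n] c(1) by (simp add: field_simps)
    then show "(\<lambda>n. z n - x) \<longlonglongrightarrow> 0"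
      by (intro tendsto_0_le[OF lim, where K = "1 / c"] always_eventually allI)
  next
    assume "(\<lambda>n. z n - x) \<longlonglongrightarrow> 0"
    then show "(\<lambda>n. T (z n - x)) \<longlonglongrightarrow> 0"
      by (rule tendsto_0_le[where K = C]) (simp add: C mem mult.commute)
  qed
  also have "\<dots> \<longleftrightarrow> z \<longlonglongrightarrow> x"
    by (rule LIM_zero_iff)
  finally show ?thesis .
qed

lemma embedding_sums_iff:
  assumes emb: "norm_isomorphic_embedding_on Z T" and c: "\<And>k. c k \<in> Z" and x: "x \<in> Z"
  shows "(\<lambda>k. T (c k)) sums T x \<longleftrightarrow> c sums x"
proof -
  have lin: "linear_operator_on Z T"
    using emb unfolding norm_isomorphic_embedding_on_def by blast
  have "(\<Sum>k<n. c k) \<in> Z" for n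
    using lin c unfolding linear_operator_on_def by (blast intro: subspace_sum)
  from embedding_tendsto_iff[OF emb this x] show ?thesis
    by (simp add: sums_def linear_operator_on_sum[OF lin c])
qed

lemma embedding_inj_on:
  assumes emb: "norm_isomorphic_embedding_on Z T"
  shows "inj_on T Z"
proof (rule inj_onI)
  fix x y assume xy: "x \<in> Z" "y \<in> Z" "T x = T y"
  \<comment> \<open>Since \<open>T y = T x\<close>, the images of the constant sequence
    \<open>y\<close> converge to \<open>T x\<close>; reflecting this convergence identifies
    \<open>x\<close> and \<open>y\<close>.\<close>
  then have "(\<lambda>_. y) \<longlonglongrightarrow> x"
    using embedding_tendsto_iff[OF emb, of "\<lambda>_. y" x] by simp
  then show "x = y"
    by (simp add: LIMSEQ_const_iff)
qed

text \<open>The lower bound pulls a convergent sequence of images back to a Cauchy sequence in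
  \<open>S\<close>; completeness of the domain space provides its limit, and closedness keeps that
  limit in \<open>S\<close>.\<close>

lemma embedding_closed_image:
  fixes Z :: "'a::banach set" and T :: "'a \<Rightarrow> 'b::real_normed_vector"
  assumes emb: "norm_isomorphic_embedding_on Z T" and S: "closed S" "S \<subseteq> Z"
  shows "closed (T ` S)"
  unfolding closed_sequential_limits
proof (intro allI impI, elim conjE)
  fix v y assume v: "\<forall>n. v n \<in> T ` S" and y: "v \<longlonglongrightarrow> y"
  obtain c where c: "c > 0" "\<And>w. w \<in> Z \<Longrightarrow> c * norm w \<le> norm (T w)"
    and lin: "linear_operator_on Z T"
    using emb unfolding norm_isomorphic_embedding_on_def by blast
  obtain s where s: "\<And>n. s n \<in> S" "v = (\<lambda>n. T (s n))"
    using v unfolding image_iff fun_eq_iff by metis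
  have "Cauchy s"
  proof (rule CauchyI)
    fix e :: real assume "e > 0"
    \<comment> \<open>The tolerance \<open>c * e\<close> absorbs the factor \<open>c\<close> lost
      when passing from images to preimages.\<close>
    then obtain N where N: "\<And>m n. m \<ge> N \<Longrightarrow> n \<ge> N \<Longrightarrow> norm (v m - v n) < c * e"
      using CauchyD[OF LIMSEQ_imp_Cauchy[OF y], of "c * e"] c(1) by auto
    have "norm (s m - s n) < e" if "m \<ge> N" "n \<ge> N" for m n
    proof -
      have Z: "s m \<in> Z" "s n \<in> Z"
        using s(1) S(2) by auto
      then have "s m - s n \<in> Z"
        using lin unfolding linear_operator_on_def by (blast intro: subspace_diff)
      from c(2)[OF this] have "c * norm (s m - s n) \<le> norm (v m - v n)"
        by (simp add: s(2) linear_operator_on_diff[OF lin Z])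
      also have "\<dots> < c * e"
        by (rule N) fact+
      finally show ?thesis
        using c(1) by simp
    qed
    then show "\<exists>M. \<forall>m\<ge>M. \<forall>n\<ge>M. norm (s m - s n) < e"
      by blast
  qed
  then obtain x where x: "s \<longlonglongrightarrow> x"
    by (auto simp: Cauchy_convergent_iff convergent_def)
  have "x \<in> S"
    using closed_sequentially[OF S(1) s(1) x] .
  moreover have "v \<longlonglongrightarrow> T x"
    using embedding_tendsto_iff[OF emb, of s x] s(1) S(2) \<open>x \<in> S\<close> x
    by (simp add: s(2) subset_eq)
  ultimately show "y \<in> T ` S"
    using LIMSEQ_unique[OF y] by blast
qed

section \<open>Closed linear spans\<close>

lemma subset_closed_span: "X k \<subseteq> closed_span X"
proof -
  have "X k \<subseteq> span (\<Union>k. X k)"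
    by (blast intro: span_base)
  also have "\<dots> \<subseteq> closed_span X"
    unfolding closed_span_def by (rule closure_subset)
  finally show ?thesis .
qed

lemma closed_span_minimal:
  assumes "subspace S" "closed S" "\<And>k. X k \<subseteq> S"
  shows "closed_span X \<subseteq> S"
  unfolding closed_span_def
proof (rule closure_minimal)
  show "span (\<Union>k. X k) \<subseteq> S"
    using assms by (simp add: span_minimal UN_subset_iff)
qed fact

lemma sums_in_closed_span:
  assumes "\<And>k. c k \<in> X k" "c sums x"
  shows "x \<in> closed_span X"
  unfolding closed_span_def closure_sequential
proof (intro exI conjI allI)
  show "(\<lambda>n. \<Sum>k<n. c k) \<longlonglongrightarrow> x"
    using assms(2) by (simp add: sums_def)
  show "(\<Sum>k<n. c k) \<in> span (\<Union>k. X k)" for n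
    using assms(1) by (intro span_sum) (blast intro: span_base)
qed

section \<open>Transfer of the Schauder decomposition\<close>

lemma embedding_is_expansion_iff:
  assumes emb: "norm_isomorphic_embedding_on (closed_span X) T" and x: "x \<in> closed_span X"
  shows "is_expansion (\<lambda>k. T ` X k) d (T x) \<longleftrightarrow> (\<exists>c. is_expansion X c x \<and> d = (\<lambda>k. T (c k)))"
proof
  assume d: "is_expansion (\<lambda>k. T ` X k) d (T x)"
  then obtain c where c: "\<And>k. c k \<in> X k" "d = (\<lambda>k. T (c k))"
    unfolding is_expansion_def image_iff fun_eq_iff by metis
  then have "c k \<in> closed_span X" for k
    using subset_closed_span by blast
  from embedding_sums_iff[where c = c, OF emb this x] have "c sums x"
    using d by (simp add: is_expansion_def c(2))
  with c show "\<exists>c. is_expansion X c x \<and> d = (\<lambda>k. T (c k))"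
    unfolding is_expansion_def by blast
next
  assume "\<exists>c. is_expansion X c x \<and> d = (\<lambda>k. T (c k))"
  then obtain c where c: "\<And>k. c k \<in> X k" "c sums x" "d = (\<lambda>k. T (c k))"
    unfolding is_expansion_def by blast
  then have "c k \<in> closed_span X" for k
    using subset_closed_span by blast
  from embedding_sums_iff[where c = c, OF emb this x] show "is_expansion (\<lambda>k. T ` X k) d (T x)"
    using c by (simp add: is_expansion_def)
qed

lemma closed_span_embedding_image:
  assumes emb: "norm_isomorphic_embedding_on (closed_span X) T" and dec: "schauder_decomposition X"
  shows "closed_span (\<lambda>k. T ` X k) = T ` closed_span X"
proof
  have lin: "linear_operator_on (closed_span X) T"
    using emb unfolding norm_isomorphic_embedding_on_def by blast
  have "closed (closed_span X)" "subspace (closed_span X)"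
    using lin by (simp_all add: closed_span_def linear_operator_on_def)
  then show "closed_span (\<lambda>k. T ` X k) \<subseteq> T ` closed_span X"
    using embedding_closed_image[OF emb] linear_operator_on_subspace_image[OF lin]
    by (intro closed_span_minimal image_mono subset_closed_span) auto
next
  show "T ` closed_span X \<subseteq> closed_span (\<lambda>k. T ` X k)"
  proof (rule image_subsetI)
    fix x assume x: "x \<in> closed_span X"
    then obtain c where "is_expansion X c x"
      using dec unfolding schauder_decomposition_def by blast
    then have "is_expansion (\<lambda>k. T ` X k) (\<lambda>k. T (c k)) (T x)"
      using embedding_is_expansion_iff[OF emb x] by blast
    then show "T x \<in> closed_span (\<lambda>k. T ` X k)"
      unfolding is_expansion_def
      by (intro sums_in_closed_span[where c = "\<lambda>k. T (c k)"]) auto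
  qed
qed

lemma schauder_decomposition_embedding_image:
  assumes emb: "norm_isomorphic_embedding_on (closed_span X) T" and dec: "schauder_decomposition X"
  shows "schauder_decomposition (\<lambda>k. T ` X k)"
  unfolding schauder_decomposition_def closed_span_embedding_image[OF emb dec]
proof (intro conjI allI ballI)
  have lin: "linear_operator_on (closed_span X) T"
    using emb unfolding norm_isomorphic_embedding_on_def by blast
  fix k
  have X: "subspace (X k)" "closed (X k)" "X k \<noteq> {0}"
    using dec unfolding schauder_decomposition_def by auto
  show "subspace (T ` X k)"
    by (rule linear_operator_on_subspace_image[OF lin X(1) subset_closed_span])
  show "closed (T ` X k)"
    by (rule embedding_closed_image[OF emb X(2) subset_closed_span])
  \<comment> \<open>Injectivity is available only on \<open>closed_span X\<close>, so
    \<open>{0}\<close> must lie there before \<open>T\<close> X k = T \<open>{0}\<close> can be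
    cancelled to \<open>X k = {0}\<close>.\<close>
  have "{0} \<subseteq> closed_span X"
    using X(1) subset_closed_span[of X k] subspace_0 by blast
  then show "T ` X k \<noteq> {0}"
    using inj_on_image_eq_iff[OF embedding_inj_on[OF emb] subset_closed_span, of "{0}" k]
      X(3) linear_operator_on_zero[OF lin] by simp
next
  fix y assume "y \<in> T ` closed_span X"
  then obtain x where x: "x \<in> closed_span X" "y = T x"
    by blast
  then have "\<exists>!c. is_expansion X c x"
    using dec unfolding schauder_decomposition_def by blast
  then show "\<exists>!d. is_expansion (\<lambda>k. T ` X k) d y"
    unfolding x(2) embedding_is_expansion_iff[OF emb x(1)] by blast
qed

section \<open>Canonical projections\<close>

lemma is_expansion_the:
  assumes "schauder_decomposition X" "x \<in> closed_span X"
  shows "is_expansion X (THE c. is_expansion X c x) x"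
proof -
  have "\<exists>!c. is_expansion X c x"
    using assms unfolding schauder_decomposition_def by simp
  then show ?thesis
    by (rule theI')
qed

text \<open>Keeps the projections inside the domain on which \<open>T\<close> is linear, so that
  \<open>T\<close> may be applied to differences involving them.\<close>

lemma canonical_proj_in_closed_span:
  assumes "schauder_decomposition X" "x \<in> closed_span X"
  shows "canonical_proj X n x \<in> closed_span X"
proof -
  have "(\<Sum>k<n. (THE c. is_expansion X c x) k) \<in> span (\<Union>k. X k)"
    using is_expansion_the[OF assms] unfolding is_expansion_def
    by (intro span_sum) (blast intro: span_base)
  then show ?thesis
    unfolding canonical_proj_def closed_span_def using closure_subset by blast
qed

text \<open>By uniqueness, the expansion of \<open>T x\<close> selected by \<open>THE\<close> is the
  image of the one selected for \<open>x\<close>; linearity then moves \<open>T\<close> out of the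
  finite sum.\<close>

lemma canonical_proj_embedding_image:
  assumes emb: "norm_isomorphic_embedding_on (closed_span X) T" and dec: "schauder_decomposition X"
    and x: "x \<in> closed_span X"
  shows "canonical_proj (\<lambda>k. T ` X k) n (T x) = T (canonical_proj X n x)"
proof -
  define c where "c = (THE c. is_expansion X c x)"
  have c: "is_expansion X c x"
    unfolding c_def by (rule is_expansion_the[OF dec x])
  have uniq: "\<exists>!d. is_expansion (\<lambda>k. T ` X k) d (T x)"
    using schauder_decomposition_embedding_image[OF emb dec] x
    unfolding schauder_decomposition_def closed_span_embedding_image[OF emb dec] by blast
  have "is_expansion (\<lambda>k. T ` X k) (\<lambda>k. T (c k)) (T x)"
    using embedding_is_expansion_iff[OF emb x] c by blast
  then have d: "(THE d. is_expansion (\<lambda>k. T ` X k) d (T x)) = (\<lambda>k. T (c k))"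
    by (rule the1_equality[OF uniq])
  have lin: "linear_operator_on (closed_span X) T"
    using emb unfolding norm_isomorphic_embedding_on_def by blast
  have "c k \<in> closed_span X" for k
    using c subset_closed_span unfolding is_expansion_def by blast
  then show ?thesis
    unfolding canonical_proj_def d c_def[symmetric]
    by (simp add: linear_operator_on_sum[OF lin])
qed

theorem proposition5p6:
  fixes X :: "nat \<Rightarrow> 'a::banach_lattice set"
    and T :: "'a \<Rightarrow> 'b::banach_lattice"
  assumes "bidecomposition X"
    and "seq_unif_continuous_on (closed_span X) T"
    and "norm_isomorphic_embedding_on (closed_span X) T"
  shows "bidecomposition (\<lambda>k. T ` X k)"
proof -
  note emb = assms(3)
  have dec: "schauder_decomposition X"
    and conv: "\<And>x. x \<in> closed_span X \<Longrightarrow> unif_tendsto (\<lambda>n. canonical_proj X n x) x"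
    using assms(1) unfolding bidecomposition_def by auto
  have lin: "linear_operator_on (closed_span X) T"
    using assms(2) unfolding seq_unif_continuous_on_def by blast
  have "unif_tendsto (\<lambda>n. canonical_proj (\<lambda>k. T ` X k) n (T x)) (T x)"
    if x: "x \<in> closed_span X" for x
  proof -
    note proj = canonical_proj_in_closed_span[OF dec x]
    have "canonical_proj X n x - x \<in> closed_span X" for n
      using lin proj x unfolding linear_operator_on_def by (blast intro: subspace_diff)
    \<comment> \<open>Uniform convergence depends only on the differences from the limit, so the
      same regulator serves.\<close>
    moreover have "unif_tendsto (\<lambda>n. canonical_proj X n x - x) 0"
      using conv[OF x] unfolding unif_tendsto_def by simp
    ultimately have "unif_tendsto (\<lambda>n. T (canonical_proj X n x - x)) 0"
      using assms(2)[unfolded seq_unif_continuous_on_def, THEN conjunct2, rule_format,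
          of "\<lambda>n. canonical_proj X n x - x"] by blast
    \<comment> \<open>The regulator in the target lattice is the one supplied by sequential uniform
      continuity; intertwining and linearity turn \<open>T (canonical_proj X n x - x)\<close> into
      the required difference.\<close>
    then show ?thesis
      unfolding unif_tendsto_def canonical_proj_embedding_image[OF emb dec x]
        linear_operator_on_diff[OF lin proj x] by simp
  qed
  then show ?thesis
    unfolding bidecomposition_def closed_span_embedding_image[OF emb dec]
    using schauder_decomposition_embedding_image[OF emb dec] by blast
qed

end
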